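(* Let $K$ be a field of characteristic zero and let $A$ be a commutative unital $K$-algebra which is a $\lambda$-ring with Adams operations $\psi^n$ ($n\ge 1$) satisfying $\psi^n|_K=\mathrm{id}$. Let $\mathsf{QS}(A)=\bigoplus_{k\ge0}A^{\otimes k}$ be the quasi-shuffle algebra of $A$. For $n\ge1$ let $Z_n:\mathsf{QS}(A)\to A$ be the $K$-linear map with $Z_n(1_K)=1$ and $$Z_n(a_1\otimes\dots\otimes a_l)=\sum_{n>n_1>\dots>n_l>0}\prod_{i=1}^l\psi^{n_i}(a_i),\qquad l\ge1.$$ Then $Z_n:\mathsf{QS}(A)\to A$ is an algebra morphism for all $n\ge1$.
   Context: Tensor products are over $K$, $A^{\otimes0}=K$. Since $A$ is a $\mathbb Q$-algebra, the $\lambda$-ring structure amounts to its Adams operations: ring endomorphisms $\psi^n:A\to A$ ($n\ge1$) with $\psi^1=\mathrm{id}$ and $\psi^m\psi^n=\psi^{mn}$. The quasi-shuffle algebra $\mathsf{QS}(A)$ carries the $K$-bilinear quasi-shuffle product $*$ with unit $1_K\in A^{\otimes 0}$, defined inductively by $1_K*u=u*1_K=u$ and $$(au)*(bv)=a(u*bv)+b(au*v)+(ab)(u*v),\qquad a,b\in A,\ u,v\in\mathsf{QS}(A),$$ where $au$ denotes $a\otimes u$ and $ab$ in the last term is the product in $A$. The sum runs over integers $n_1,\dots,n_l$ with the stated inequalities (an empty sum is $0$). *)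

theory Defs
  imports Complex_Main "HOL-Library.Poly_Mapping"
begin

section \<open>Commutative algebras over a field, with Adams operations\<close>

text \<open>
  The ground field and the algebra are types; the \<open>K\<close>-algebra structure is given by the scalar
  multiplication, and \<open>K\<close> sits inside \<open>A\<close> as the set of all \<open>scale c 1\<close>.
\<close>

locale comm_algebra = vector_space scale
  for scale :: "'k::field \<Rightarrow> 'a::comm_ring_1 \<Rightarrow> 'a" +
  assumes scale_mult_left: "scale c (a * b) = scale c a * b"

text \<open>
  Over a field of characteristic zero the \<open>\<lambda>\<close>-ring structure is the same thing as its Adams
  operations \<open>psi n\<close>, \<open>n \<ge> 1\<close>. The value \<open>psi 0\<close> is unconstrained and never used.
\<close>

locale adams_algebra = comm_algebra scale
  for scale :: "'k::field_char_0 \<Rightarrow> 'a::comm_ring_1 \<Rightarrow> 'a" +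
  fixes psi :: "nat \<Rightarrow> 'a \<Rightarrow> 'a"
  assumes psi_add: "n \<ge> 1 \<Longrightarrow> psi n (a + b) = psi n a + psi n b"
    and psi_mult: "n \<ge> 1 \<Longrightarrow> psi n (a * b) = psi n a * psi n b"
    and psi_unit: "n \<ge> 1 \<Longrightarrow> psi n 1 = 1"
    and psi_index_one: "psi 1 a = a"
    and psi_comp: "m \<ge> 1 \<Longrightarrow> n \<ge> 1 \<Longrightarrow> psi m (psi n a) = psi (m * n) a"
    and psi_ground: "n \<ge> 1 \<Longrightarrow> psi n (scale c 1) = scale c 1"


section \<open>The free vector space on words\<close>

definition fscale :: "'k::field \<Rightarrow> ('w \<Rightarrow>\<^sub>0 'k) \<Rightarrow> ('w \<Rightarrow>\<^sub>0 'k)" where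
  "fscale c f = Poly_Mapping.map ((*) c) f"

definition word :: "'w \<Rightarrow> ('w \<Rightarrow>\<^sub>0 'k::field)" where
  "word w = Poly_Mapping.single w 1"

definition lin_ext ::
  "('k::field \<Rightarrow> 'b \<Rightarrow> 'b) \<Rightarrow> ('w \<Rightarrow> 'b) \<Rightarrow> ('w \<Rightarrow>\<^sub>0 'k) \<Rightarrow> 'b::ab_group_add" where
  "lin_ext s F f = (\<Sum>w\<in>Poly_Mapping.keys f. s (Poly_Mapping.lookup f w) (F w))"

lemma lookup_fscale [simp]:
  "Poly_Mapping.lookup (fscale c f) w = c * Poly_Mapping.lookup f w"
  by (simp add: fscale_def Poly_Mapping.map.rep_eq when_def)

global_interpretation free: vector_space "fscale :: 'k::field \<Rightarrow> ('w \<Rightarrow>\<^sub>0 'k) \<Rightarrow> _"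
  by unfold_locales (auto intro!: poly_mapping_eqI simp: lookup_add algebra_simps)

lemma lin_ext_superset:
  assumes "vector_space s" "finite S" "Poly_Mapping.keys f \<subseteq> S"
  shows "lin_ext s F f = (\<Sum>w\<in>S. s (Poly_Mapping.lookup f w) (F w))"
proof -
  interpret vector_space s by fact
  show ?thesis unfolding lin_ext_def
    using assms(2,3) by (intro sum.mono_neutral_left) (auto simp: in_keys_iff)
qed

lemma lin_ext_linear:
  assumes "vector_space s"
  shows "Vector_Spaces.linear fscale s (lin_ext s F)"
proof -
  interpret vector_space s by fact
  show ?thesis
  proof unfold_locales
    fix f g :: "'c \<Rightarrow>\<^sub>0 'a"
    have "Poly_Mapping.keys (f + g) \<subseteq> Poly_Mapping.keys f \<union> Poly_Mapping.keys g"
      by (rule keys_add)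
    then show "lin_ext s F (f + g) = lin_ext s F f + lin_ext s F g"
      using lin_ext_superset[OF assms, of "Poly_Mapping.keys f \<union> Poly_Mapping.keys g" _ F]
      by (simp add: lookup_add scale_left_distrib sum.distrib)
  next
    fix c and f :: "'c \<Rightarrow>\<^sub>0 'a"
    have "Poly_Mapping.keys (fscale c f) \<subseteq> Poly_Mapping.keys f"
      by (auto simp: in_keys_iff)
    then show "lin_ext s F (fscale c f) = s c (lin_ext s F f)"
      using lin_ext_superset[OF assms, of "Poly_Mapping.keys f" _ F]
      by (simp add: scale_sum_right)
  qed
qed

lemma lin_ext_word:
  assumes "vector_space s"
  shows "lin_ext s F (word w) = F w"
proof -
  interpret vector_space s by fact
  show ?thesis by (simp add: lin_ext_def word_def)
qed

lemma free_expand: "f = (\<Sum>w\<in>Poly_Mapping.keys f. fscale (Poly_Mapping.lookup f w) (word w))"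
proof (rule poly_mapping_eqI)
  fix k
  show "Poly_Mapping.lookup f k =
    Poly_Mapping.lookup (\<Sum>w\<in>Poly_Mapping.keys f. fscale (Poly_Mapping.lookup f w) (word w)) k"
    by (simp add: lookup_sum word_def lookup_single when_def in_keys_iff
        if_distrib[of "\<lambda>x. _ * x"] cong: if_cong)
qed

lemma free_induct [case_names zero add word]:
  assumes "P 0" "\<And>f g. P f \<Longrightarrow> P g \<Longrightarrow> P (f + g)" "\<And>c w. P (fscale c (word w))"
  shows "P f"
proof -
  have "P (\<Sum>w\<in>S. fscale (Poly_Mapping.lookup f w) (word w))" if "finite S" for S
    using that by (induction S rule: finite_induct) (auto intro: assms)
  then show ?thesis using free_expand[of f] by (metis finite_keys)
qed


section \<open>The quasi-shuffle algebra as a vector space\<close>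

text \<open>
  The direct sum of all tensor powers of \<open>A\<close> is the vector space spanned by all words
  \<open>[a\<^sub>1, \<dots>, a\<^sub>k]\<close> over \<open>A\<close>, of all lengths \<open>k \<ge> 0\<close>, modulo multilinearity in each letter: the
  relations only involve words of one length, so that the quotient is graded by length, with the
  words of length \<open>k\<close> giving the \<open>k\<close>-th tensor power over \<open>K\<close> and the empty word spanning the
  copy of \<open>K\<close> in degree \<open>0\<close>. The universal property is lemma \<open>qs_universal\<close> below.
\<close>

definition tensor_relators ::
  "('k::field \<Rightarrow> 'a \<Rightarrow> 'a) \<Rightarrow> ('a::comm_ring_1 list \<Rightarrow>\<^sub>0 'k) set" where
  "tensor_relators scale =
     {word (u @ (a + b) # v) - word (u @ a # v) - word (u @ b # v) | u a b v. True} \<union>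
     {word (u @ scale c a # v) - fscale c (word (u @ a # v)) | u c a v. True}"

definition tensor_null ::
  "('k::field \<Rightarrow> 'a \<Rightarrow> 'a) \<Rightarrow> ('a::comm_ring_1 list \<Rightarrow>\<^sub>0 'k) set" where
  "tensor_null scale = free.span (tensor_relators scale)"

text \<open>
  The quotient depends on \<open>scale\<close>, hence is not a type: its elements are the cosets of
  \<open>tensor_null scale\<close>.
\<close>

type_synonym ('k, 'a) qs = "('a list \<Rightarrow>\<^sub>0 'k) set"

definition qs_class ::
  "('k::field \<Rightarrow> 'a \<Rightarrow> 'a) \<Rightarrow> ('a::comm_ring_1 list \<Rightarrow>\<^sub>0 'k) \<Rightarrow> ('k, 'a) qs" where
  "qs_class scale f = {g. g - f \<in> tensor_null scale}"

definition QS :: "('k::field \<Rightarrow> 'a \<Rightarrow> 'a) \<Rightarrow> ('k, 'a::comm_ring_1) qs set" where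
  "QS scale = range (qs_class scale)"

definition qs_rep :: "('k, 'a) qs \<Rightarrow> ('a::comm_ring_1 list \<Rightarrow>\<^sub>0 'k::field)" where
  "qs_rep X = (SOME f. f \<in> X)"

definition qs_add ::
  "('k::field \<Rightarrow> 'a \<Rightarrow> 'a) \<Rightarrow> ('k, 'a::comm_ring_1) qs \<Rightarrow> ('k, 'a) qs \<Rightarrow> ('k, 'a) qs" where
  "qs_add scale X Y = qs_class scale (qs_rep X + qs_rep Y)"

definition qs_scale ::
  "('k::field \<Rightarrow> 'a \<Rightarrow> 'a) \<Rightarrow> 'k \<Rightarrow> ('k, 'a::comm_ring_1) qs \<Rightarrow> ('k, 'a) qs" where
  "qs_scale scale c X = qs_class scale (fscale c (qs_rep X))"

definition qs_tensor ::
  "('k::field \<Rightarrow> 'a \<Rightarrow> 'a) \<Rightarrow> 'a::comm_ring_1 list \<Rightarrow> ('k, 'a) qs" where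
  "qs_tensor scale w = qs_class scale (word w)"

definition qs_one :: "('k::field \<Rightarrow> 'a \<Rightarrow> 'a) \<Rightarrow> ('k, 'a::comm_ring_1) qs" where
  "qs_one scale = qs_tensor scale []"


section \<open>The quasi-shuffle product\<close>

definition fcons :: "'a \<Rightarrow> ('a list \<Rightarrow>\<^sub>0 'k::field) \<Rightarrow> ('a list \<Rightarrow>\<^sub>0 'k)" where
  "fcons a = lin_ext fscale (\<lambda>w. word (a # w))"

fun quasi_shuffle ::
  "'a::comm_ring_1 list \<Rightarrow> 'a list \<Rightarrow> ('a list \<Rightarrow>\<^sub>0 'k::field)" where
  "quasi_shuffle [] v = word v"
| "quasi_shuffle (a # u) [] = word (a # u)"
| "quasi_shuffle (a # u) (b # v) =
     fcons a (quasi_shuffle u (b # v)) + fcons b (quasi_shuffle (a # u) v)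
       + fcons (a * b) (quasi_shuffle u v)"

definition ftimes ::
  "('a::comm_ring_1 list \<Rightarrow>\<^sub>0 'k::field) \<Rightarrow> ('a list \<Rightarrow>\<^sub>0 'k) \<Rightarrow> ('a list \<Rightarrow>\<^sub>0 'k)" where
  "ftimes f g = lin_ext fscale (\<lambda>u. lin_ext fscale (\<lambda>v. quasi_shuffle u v) g) f"

text \<open>
  Independence of the representatives is part of the lemmas below, in particular
  \<open>qs_cons_class\<close>, \<open>qs_times_class\<close> and \<open>qs_times_cons\<close>, which is the recursion for the product on
  the quotient.
\<close>

definition qs_cons ::
  "('k::field \<Rightarrow> 'a \<Rightarrow> 'a) \<Rightarrow> 'a::comm_ring_1 \<Rightarrow> ('k, 'a) qs \<Rightarrow> ('k, 'a) qs" where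
  "qs_cons scale a X = qs_class scale (fcons a (qs_rep X))"

definition qs_times ::
  "('k::field \<Rightarrow> 'a \<Rightarrow> 'a) \<Rightarrow> ('k, 'a::comm_ring_1) qs \<Rightarrow> ('k, 'a) qs \<Rightarrow> ('k, 'a) qs" where
  "qs_times scale X Y = qs_class scale (ftimes (qs_rep X) (qs_rep Y))"


section \<open>Truncated multiple sums and algebra morphisms\<close>

definition index_lists :: "nat \<Rightarrow> nat \<Rightarrow> nat list set" where
  "index_lists n l = {ns. length ns = l \<and> sorted_wrt (>) ns \<and> set ns \<subseteq> {0<..<n}}"

definition multi_sum :: "(nat \<Rightarrow> 'a \<Rightarrow> 'a) \<Rightarrow> nat \<Rightarrow> 'a::comm_ring_1 list \<Rightarrow> 'a" where
  "multi_sum psi n as =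
     (\<Sum>ns\<in>index_lists n (length as). \<Prod>i<length as. psi (ns ! i) (as ! i))"

text \<open>
  For the empty word the only index list is \<open>[]\<close>, so that \<open>multi_sum psi n [] = 1\<close>.
\<close>

definition Z ::
  "('k::field \<Rightarrow> 'a \<Rightarrow> 'a) \<Rightarrow> (nat \<Rightarrow> 'a \<Rightarrow> 'a) \<Rightarrow> nat \<Rightarrow> ('k, 'a::comm_ring_1) qs \<Rightarrow> 'a" where
  "Z scale psi n X = lin_ext scale (multi_sum psi n) (qs_rep X)"

definition qs_linear ::
  "('k::field \<Rightarrow> 'a \<Rightarrow> 'a) \<Rightarrow> ('k \<Rightarrow> 'b \<Rightarrow> 'b) \<Rightarrow> (('k, 'a::comm_ring_1) qs \<Rightarrow> 'b::ab_group_add) \<Rightarrow> bool"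
  where "qs_linear scale s f \<longleftrightarrow>
     (\<forall>X\<in>QS scale. \<forall>Y\<in>QS scale. f (qs_add scale X Y) = f X + f Y) \<and>
     (\<forall>c. \<forall>X\<in>QS scale. f (qs_scale scale c X) = s c (f X))"

definition qs_algebra_morphism ::
  "('k::field \<Rightarrow> 'a \<Rightarrow> 'a) \<Rightarrow> (('k, 'a::comm_ring_1) qs \<Rightarrow> 'a) \<Rightarrow> bool" where
  "qs_algebra_morphism scale f \<longleftrightarrow>
     qs_linear scale scale f \<and> f (qs_one scale) = 1 \<and>
     (\<forall>X\<in>QS scale. \<forall>Y\<in>QS scale. f (qs_times scale X Y) = f X * f Y)"


section \<open>Basic facts: the quotient\<close>

lemma subspace_tensor_null: "free.subspace (tensor_null scale)"
  by (simp add: tensor_null_def)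

lemma null_0 [simp]: "0 \<in> tensor_null scale"
  by (rule free.subspace_0[OF subspace_tensor_null])

lemma null_add: "f \<in> tensor_null scale \<Longrightarrow> g \<in> tensor_null scale \<Longrightarrow> f + g \<in> tensor_null scale"
  by (rule free.subspace_add[OF subspace_tensor_null])

lemma null_diff: "f \<in> tensor_null scale \<Longrightarrow> g \<in> tensor_null scale \<Longrightarrow> f - g \<in> tensor_null scale"
  by (rule free.subspace_diff[OF subspace_tensor_null])

lemma null_scale: "f \<in> tensor_null scale \<Longrightarrow> fscale c f \<in> tensor_null scale"
  by (rule free.subspace_scale[OF subspace_tensor_null])

lemma null_linear_image:
  assumes "Vector_Spaces.linear fscale s F" "\<And>r. r \<in> tensor_relators scale \<Longrightarrow> F r \<in> W"
    "module.subspace s W" "f \<in> tensor_null scale"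
  shows "F f \<in> W"
proof -
  interpret F: Vector_Spaces.linear fscale s F by fact
  have "free.subspace {f. F f \<in> W}"
    using assms(3) unfolding free.subspace_def F.vs2.subspace_def
    by (auto simp: F.zero F.add F.scale)
  then show ?thesis
    using free.span_minimal[of "tensor_relators scale" "{f. F f \<in> W}"] assms(2,4)
    by (auto simp: tensor_null_def)
qed

lemma qs_class_eq_iff: "qs_class scale f = qs_class scale g \<longleftrightarrow> f - g \<in> tensor_null scale"
proof
  assume "qs_class scale f = qs_class scale g"
  moreover have "f \<in> qs_class scale f" by (simp add: qs_class_def)
  ultimately show "f - g \<in> tensor_null scale" by (simp add: qs_class_def)
next
  assume a: "f - g \<in> tensor_null scale"
  have "h - f \<in> tensor_null scale \<longleftrightarrow> h - g \<in> tensor_null scale" for h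
    using null_add[OF _ a, of "h - f"] null_diff[OF _ a, of "h - g"] by auto
  then show "qs_class scale f = qs_class scale g" by (simp add: qs_class_def)
qed

lemma qs_rep_class: "qs_rep (qs_class scale f) - f \<in> tensor_null scale"
proof -
  have "f \<in> qs_class scale f" by (simp add: qs_class_def)
  then have "qs_rep (qs_class scale f) \<in> qs_class scale f"
    unfolding qs_rep_def by (rule someI)
  then show ?thesis by (simp add: qs_class_def)
qed

lemma qs_class_rep: "X \<in> QS scale \<Longrightarrow> qs_class scale (qs_rep X) = X"
  using qs_rep_class by (auto simp: QS_def simp flip: qs_class_eq_iff)

lemma qs_class_in_QS [simp]: "qs_class scale f \<in> QS scale"
  by (simp add: QS_def)

lemma qs_add_class: "qs_add scale (qs_class scale f) (qs_class scale g) = qs_class scale (f + g)"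
  using null_add[OF qs_rep_class qs_rep_class, of scale f g]
  by (simp add: qs_add_def qs_class_eq_iff algebra_simps)

lemma qs_scale_class: "qs_scale scale c (qs_class scale f) = qs_class scale (fscale c f)"
  using null_scale[OF qs_rep_class, of c scale f]
  by (simp add: qs_scale_def qs_class_eq_iff free.scale_right_diff_distrib)

lemma qs_cases:
  assumes "X \<in> QS scale" obtains f where "X = qs_class scale f"
  using assms by (auto simp: QS_def)

lemma lin_ext_rep:
  fixes scale :: "'k::field \<Rightarrow> 'a::comm_ring_1 \<Rightarrow> 'a" and s :: "'k \<Rightarrow> 'b::ab_group_add \<Rightarrow> 'b"
  assumes "vector_space s"
    and "\<And>u a b v. F (u @ (a + b) # v) = F (u @ a # v) + F (u @ b # v)"
    and "\<And>u c a v. F (u @ scale c a # v) = s c (F (u @ a # v))"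
  shows "lin_ext s F (qs_rep (qs_class scale f)) = lin_ext s F f"
proof -
  interpret l: Vector_Spaces.linear fscale s "lin_ext s F"
    by (rule lin_ext_linear) fact
  have "lin_ext s F (qs_rep (qs_class scale f) - f) \<in> {0}"
  proof (rule null_linear_image[OF l.linear_axioms _ _ qs_rep_class])
    fix r assume "r \<in> tensor_relators scale"
    then show "lin_ext s F r \<in> {0}"
      using assms(2,3)
      by (auto simp: tensor_relators_def l.diff l.scale lin_ext_word[OF assms(1)])
  qed (simp add: l.vs2.subspace_single_0)
  then show ?thesis by (simp add: l.diff)
qed

text \<open>Linear maps out of the quotient are families of multilinear maps, one for each length.\<close>

lemma qs_universal:
  fixes scale :: "'k::field \<Rightarrow> 'a::comm_ring_1 \<Rightarrow> 'a" and s :: "'k \<Rightarrow> 'b::ab_group_add \<Rightarrow> 'b"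
  assumes "vector_space s"
    and "\<And>u a b v. F (u @ (a + b) # v) = F (u @ a # v) + F (u @ b # v)"
    and "\<And>u c a v. F (u @ scale c a # v) = s c (F (u @ a # v))"
  shows "qs_linear scale s (\<lambda>X. lin_ext s F (qs_rep X))" (is ?linear)
    and "lin_ext s F (qs_rep (qs_tensor scale w)) = F w" (is ?value)
    and "\<And>G X. qs_linear scale s G \<Longrightarrow> (\<And>w. G (qs_tensor scale w) = F w) \<Longrightarrow>
           X \<in> QS scale \<Longrightarrow> G X = lin_ext s F (qs_rep X)"
proof -
  interpret l: Vector_Spaces.linear fscale s "lin_ext s F"
    by (rule lin_ext_linear) fact
  note rep = lin_ext_rep[where scale = scale, OF assms]
  show ?linear
    by (auto simp: qs_linear_def qs_add_class qs_scale_class rep l.add l.scale elim!: qs_cases)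
  show ?value
    by (simp add: qs_tensor_def rep lin_ext_word[OF assms(1)])
  fix G X
  assume G: "qs_linear scale s G" and w: "\<And>w. G (qs_tensor scale w) = F w"
    and X: "X \<in> QS scale"
  have add: "G (qs_class scale (f + g)) = G (qs_class scale f) + G (qs_class scale g)" for f g
    using G by (simp add: qs_linear_def flip: qs_add_class)
  have sc: "G (qs_class scale (fscale c f)) = s c (G (qs_class scale f))" for c f
    using G by (simp add: qs_linear_def flip: qs_scale_class)
  have "G (qs_class scale f) = lin_ext s F f" for f
  proof (induction f rule: free_induct)
    case zero
    show ?case using sc[of 0 0] by simp
  next
    case (word c w)
    show ?case using w[of w]
      by (simp add: sc l.scale lin_ext_word[OF assms(1)] qs_tensor_def)
  qed (simp add: add l.add)
  then show "G X = lin_ext s F (qs_rep X)"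
    using qs_class_rep[OF X] by metis
qed


section \<open>Basic facts: the product\<close>

lemma fcons_linear: "Vector_Spaces.linear fscale fscale (fcons a)"
  unfolding fcons_def by (rule lin_ext_linear) unfold_locales

global_interpretation fcons: Vector_Spaces.linear fscale fscale "fcons a"
  by (rule fcons_linear)

lemma fcons_word: "fcons a (word w) = word (a # w)"
  unfolding fcons_def by (rule lin_ext_word) unfold_locales

lemma relator_add_null:
  "word (u @ (a + b) # v) - word (u @ a # v) - word (u @ b # v) \<in> tensor_null scale"
  unfolding tensor_null_def tensor_relators_def by (rule free.span_base) blast

lemma relator_scale_null:
  "word (u @ scale c a # v) - fscale c (word (u @ a # v)) \<in> tensor_null scale"
  unfolding tensor_null_def tensor_relators_def by (rule free.span_base) blast

lemma tensor_null_image: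
  assumes "f \<in> tensor_null scale" and "Vector_Spaces.linear fscale fscale F"
    and add: "\<And>u a b v.
      F (word (u @ (a + b) # v) - word (u @ a # v) - word (u @ b # v)) \<in> tensor_null scale"
    and scale: "\<And>u c a v.
      F (word (u @ scale c a # v) - fscale c (word (u @ a # v))) \<in> tensor_null scale"
  shows "F f \<in> tensor_null scale"
proof (rule null_linear_image[OF assms(2) _ subspace_tensor_null assms(1)])
  fix r assume "r \<in> tensor_relators scale"
  then consider
    (1) u a b v where "r = word (u @ (a + b) # v) - word (u @ a # v) - word (u @ b # v)"
  | (2) u c a v where "r = word (u @ scale c a # v) - fscale c (word (u @ a # v))"
    unfolding tensor_relators_def by blast
  then show "F r \<in> tensor_null scale"
    by cases (simp_all only: add scale)
qed

lemma fcons_null: "f \<in> tensor_null scale \<Longrightarrow> fcons a f \<in> tensor_null scale"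
proof (erule tensor_null_image[OF _ fcons_linear])
  fix u v b c
  show "fcons a (word (u @ (b + c) # v) - word (u @ b # v) - word (u @ c # v)) \<in> tensor_null scale"
    using relator_add_null[of "a # u" b c v] by (simp add: fcons.diff fcons_word)
next
  fix u v c b
  show "fcons a (word (u @ scale c b # v) - fscale c (word (u @ b # v))) \<in> tensor_null scale"
    using relator_scale_null[of "a # u" scale c b v]
    by (simp add: fcons.diff fcons.scale fcons_word)
qed

lemma fcons_add_null: "fcons (a + b) f - fcons a f - fcons b f \<in> tensor_null scale"
proof (induction f rule: free_induct)
  case zero
  show ?case by simp
next
  case (add f g)
  from null_add[OF this] show ?case by (simp add: fcons.add algebra_simps)
next
  case (word c w)
  have "word ((a + b) # w) - word (a # w) - word (b # w) \<in> tensor_null scale"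
    using relator_add_null[of "[]"] by simp
  from null_scale[OF this] show ?case
    by (simp add: fcons.scale fcons_word free.scale_right_diff_distrib)
qed

lemma fcons_scale_null: "fcons (scale c a) f - fscale c (fcons a f) \<in> tensor_null scale"
proof (induction f rule: free_induct)
  case zero
  show ?case by simp
next
  case (add f g)
  from null_add[OF this] show ?case
    by (simp add: fcons.add free.scale_right_distrib algebra_simps)
next
  case (word d w)
  have "word (scale c a # w) - fscale c (word (a # w)) \<in> tensor_null scale"
    using relator_scale_null[of "[]" scale] by simp
  from null_scale[OF this, of d] show ?case
    by (simp add: fcons.scale fcons_word free.scale_right_diff_distrib mult.commute)
qed

lemma ftimes_linear_left: "Vector_Spaces.linear fscale fscale (\<lambda>f. ftimes f g)"
  unfolding ftimes_def by (rule lin_ext_linear) unfold_locales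

global_interpretation ftimes_left: Vector_Spaces.linear fscale fscale "\<lambda>f. ftimes f g"
  by (rule ftimes_linear_left)

lemma ftimes_word_left: "ftimes (word u) g = lin_ext fscale (quasi_shuffle u) g"
  unfolding ftimes_def by (subst lin_ext_word) (unfold_locales, simp)

lemma ftimes_word: "ftimes (word u) (word v) = quasi_shuffle u v"
  unfolding ftimes_word_left by (rule lin_ext_word) unfold_locales

lemma ftimes_word_left_linear: "Vector_Spaces.linear fscale fscale (ftimes (word u))"
  unfolding ftimes_word_left[abs_def] by (rule lin_ext_linear) unfold_locales

lemma quasi_shuffle_Nil [simp]: "quasi_shuffle u [] = word u"
  by (cases u) auto

lemma quasi_shuffle_commute: "quasi_shuffle u v = quasi_shuffle v u"
proof (induction u v rule: quasi_shuffle.induct)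
  case (3 a u b v)
  then show ?case by (simp add: mult.commute add.commute)
qed auto

lemma ftimes_commute: "ftimes f g = ftimes g f"
proof (induction f rule: free_induct)
  case zero
  show ?case
    using ftimes_left.zero[of g]
    by (simp add: ftimes_def lin_ext_def)
next
  case (add f1 f2)
  have "ftimes g (f1 + f2) = ftimes g f1 + ftimes g f2"
  proof (induction g rule: free_induct)
    case (word c w)
    interpret w: Vector_Spaces.linear fscale fscale "ftimes (word w)"
      by (rule ftimes_word_left_linear)
    show ?case by (simp add: ftimes_left.scale w.add free.scale_right_distrib)
  qed (simp_all add: ftimes_left.add ftimes_left.zero algebra_simps)
  then show ?case by (simp add: add ftimes_left.add)
next
  case (word c u)
  show ?case
  proof (induction g rule: free_induct)
    case zero
    interpret u: Vector_Spaces.linear fscale fscale "ftimes (word u)"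
      by (rule ftimes_word_left_linear)
    show ?case by (simp add: ftimes_left.scale ftimes_left.zero u.zero)
  next
    case (add f g)
    interpret u: Vector_Spaces.linear fscale fscale "ftimes (word u)"
      by (rule ftimes_word_left_linear)
    show ?case using add
      by (simp add: ftimes_left.scale ftimes_left.add u.add free.scale_right_distrib)
  next
    case (word d w)
    interpret u: Vector_Spaces.linear fscale fscale "ftimes (word u)"
      by (rule ftimes_word_left_linear)
    interpret w: Vector_Spaces.linear fscale fscale "ftimes (word w)"
      by (rule ftimes_word_left_linear)
    show ?case
      by (simp add: ftimes_left.scale u.scale w.scale ftimes_word quasi_shuffle_commute[of u]
          mult.commute)
  qed
qed

lemma ftimes_add_right: "ftimes f (g + h) = ftimes f g + ftimes f h"
  by (simp add: ftimes_commute[of f] ftimes_left.add)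

lemma ftimes_scale_right: "ftimes f (fscale c g) = fscale c (ftimes f g)"
  by (simp add: ftimes_commute[of f] ftimes_left.scale)

lemma ftimes_zero_right: "ftimes f 0 = 0"
  by (simp add: ftimes_commute[of f] ftimes_left.zero)

lemma ftimes_Nil_left: "ftimes (word []) g = g"
  by (induction g rule: free_induct)
    (simp_all add: ftimes_zero_right ftimes_add_right ftimes_scale_right ftimes_word)

lemma ftimes_Nil_right: "ftimes g (word []) = g"
  by (simp add: ftimes_commute[of g] ftimes_Nil_left)

lemma ftimes_cons:
  "ftimes (fcons a f) (fcons b g) =
     fcons a (ftimes f (fcons b g)) + fcons b (ftimes (fcons a f) g) + fcons (a * b) (ftimes f g)"
proof (induction f rule: free_induct)
  case zero
  show ?case by (simp add: fcons.zero ftimes_left.zero)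
next
  case (add f1 f2)
  then show ?case by (simp add: fcons.add ftimes_left.add algebra_simps)
next
  case (word c u)
  have "ftimes (word (a # u)) (fcons b g) =
     fcons a (ftimes (word u) (fcons b g)) + fcons b (ftimes (word (a # u)) g)
       + fcons (a * b) (ftimes (word u) g)"
  proof (induction g rule: free_induct)
    case zero
    show ?case by (simp add: fcons.zero ftimes_zero_right)
  next
    case (add g1 g2)
    then show ?case by (simp add: fcons.add ftimes_add_right algebra_simps)
  next
    case (word d v)
    show ?case
      by (simp add: fcons.scale ftimes_scale_right fcons_word ftimes_word free.scale_right_distrib)
  qed
  then show ?case
    by (simp add: fcons.scale ftimes_left.scale fcons_word free.scale_right_distrib)
qed

lemma fcons_times_word_null:
  assumes "\<And>v. ftimes r (word v) \<in> tensor_null scale"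
  shows "ftimes (fcons c r) (word v) \<in> tensor_null scale"
proof (induction v)
  case Nil
  show ?case using fcons_null[OF assms[of "[]"]] by (simp add: ftimes_Nil_right)
next
  case (Cons d v)
  have "ftimes (fcons c r) (fcons d (word v)) \<in> tensor_null scale"
    unfolding ftimes_cons
    using fcons_null[OF assms[of "d # v"]] fcons_null[OF assms[of v]] fcons_null[OF Cons]
    by (intro null_add) (simp_all add: fcons_word)
  then show ?case by (simp add: fcons_word)
qed

lemma fcons_add_times_null:
  fixes f :: "'a::comm_ring_1 list \<Rightarrow>\<^sub>0 'k::field"
  shows "ftimes (fcons (a + b) f - fcons a f - fcons b f) (word v) \<in> tensor_null scale"
proof (induction v)
  case Nil
  show ?case by (simp add: ftimes_Nil_right fcons_add_null)
next
  case (Cons d v)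
  define g :: "'a list \<Rightarrow>\<^sub>0 'k" where "g = word v"
  have "ftimes (fcons (a + b) f - fcons a f - fcons b f) (fcons d g) =
      (fcons (a + b) (ftimes f (fcons d g)) - fcons a (ftimes f (fcons d g))
        - fcons b (ftimes f (fcons d g)))
    + fcons d (ftimes (fcons (a + b) f - fcons a f - fcons b f) g)
    + (fcons (a * d + b * d) (ftimes f g) - fcons (a * d) (ftimes f g) - fcons (b * d) (ftimes f g))"
    by (simp add: ftimes_left.diff ftimes_left.add ftimes_cons fcons.diff fcons.add algebra_simps)
  also have "\<dots> \<in> tensor_null scale"
    using Cons by (intro null_add fcons_add_null fcons_null) (simp add: g_def)
  finally show ?case by (simp add: g_def fcons_word)
qed

context comm_algebra
begin

lemma fcons_scale_times_null:
  fixes f :: "'a list \<Rightarrow>\<^sub>0 'k"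
  shows "ftimes (fcons (scale c a) f - fscale c (fcons a f)) (word v) \<in> tensor_null scale"
proof (induction v)
  case Nil
  show ?case by (simp add: ftimes_Nil_right fcons_scale_null)
next
  case (Cons d v)
  define g :: "'a list \<Rightarrow>\<^sub>0 'k" where "g = word v"
  have "ftimes (fcons (scale c a) f - fscale c (fcons a f)) (fcons d g) =
      (fcons (scale c a) (ftimes f (fcons d g)) - fscale c (fcons a (ftimes f (fcons d g))))
    + fcons d (ftimes (fcons (scale c a) f - fscale c (fcons a f)) g)
    + (fcons (scale c (a * d)) (ftimes f g) - fscale c (fcons (a * d) (ftimes f g)))"
    by (simp add: ftimes_left.diff ftimes_left.scale ftimes_cons fcons.diff fcons.scale
        free.scale_right_distrib scale_mult_left algebra_simps)
  also have "\<dots> \<in> tensor_null scale"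
    using Cons by (intro null_add fcons_scale_null fcons_null) (simp add: g_def)
  finally show ?case by (simp add: g_def fcons_word)
qed

lemma ftimes_word_null:
  "f \<in> tensor_null scale \<Longrightarrow> ftimes f (word w) \<in> tensor_null scale"
proof (erule tensor_null_image[OF _ ftimes_linear_left])
  fix u v a b
  show "ftimes (word (u @ (a + b) # v) - word (u @ a # v) - word (u @ b # v)) (word w)
    \<in> tensor_null scale"
  proof (induction u arbitrary: w)
    case Nil
    show ?case using fcons_add_times_null[of a b "word v" w] by (simp add: fcons_word)
  next
    case (Cons c u)
    from fcons_times_word_null[OF this] show ?case by (simp add: fcons.diff fcons_word)
  qed
next
  fix u v c a
  show "ftimes (word (u @ scale c a # v) - fscale c (word (u @ a # v))) (word w)
    \<in> tensor_null scale"
  proof (induction u arbitrary: w)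
    case Nil
    show ?case using fcons_scale_times_null[of c a "word v" w] by (simp add: fcons_word)
  next
    case (Cons d u)
    from fcons_times_word_null[OF this] show ?case
      by (simp add: fcons.diff fcons.scale fcons_word)
  qed
qed

lemma ftimes_null:
  assumes "f \<in> tensor_null scale"
  shows "ftimes f g \<in> tensor_null scale"
proof (induction g rule: free_induct)
  case (word c w)
  show ?case by (simp add: ftimes_scale_right null_scale ftimes_word_null assms)
qed (simp_all add: ftimes_zero_right ftimes_add_right null_add)

lemma qs_times_class:
  "qs_times scale (qs_class scale f) (qs_class scale g) = qs_class scale (ftimes f g)"
proof -
  define f' g' where "f' = qs_rep (qs_class scale f)" and "g' = qs_rep (qs_class scale g)"
  have "ftimes f' g' - ftimes f g = ftimes (f' - f) g' + ftimes (g' - g) f"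
    by (simp add: ftimes_left.diff ftimes_commute[of g' f] ftimes_commute[of g f])
  also have "\<dots> \<in> tensor_null scale"
    unfolding f'_def g'_def by (intro null_add ftimes_null qs_rep_class)
  finally show ?thesis by (simp add: qs_times_def f'_def g'_def qs_class_eq_iff)
qed

lemma qs_cons_class: "qs_cons scale a (qs_class scale f) = qs_class scale (fcons a f)"
  using fcons_null[OF qs_rep_class, of a scale f]
  by (simp add: qs_cons_def qs_class_eq_iff fcons.diff)

lemma qs_cons_tensor: "qs_cons scale a (qs_tensor scale w) = qs_tensor scale (a # w)"
  by (simp add: qs_tensor_def qs_cons_class fcons_word)

lemma qs_cons_add:
  assumes "X \<in> QS scale" "Y \<in> QS scale"
  shows "qs_cons scale a (qs_add scale X Y) = qs_add scale (qs_cons scale a X) (qs_cons scale a Y)"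
  using assms by (auto elim!: qs_cases simp: qs_cons_class qs_add_class fcons.add)

lemma qs_cons_scale:
  assumes "X \<in> QS scale"
  shows "qs_cons scale a (qs_scale scale c X) = qs_scale scale c (qs_cons scale a X)"
  using assms by (auto elim!: qs_cases simp: qs_cons_class qs_scale_class fcons.scale)

lemma qs_times_one:
  assumes "X \<in> QS scale"
  shows "qs_times scale (qs_one scale) X = X" "qs_times scale X (qs_one scale) = X"
  using assms
  by (auto elim!: qs_cases
      simp: qs_one_def qs_tensor_def qs_times_class ftimes_Nil_left ftimes_Nil_right)

lemma qs_times_add:
  assumes "X \<in> QS scale" "Y \<in> QS scale" "W \<in> QS scale"
  shows "qs_times scale (qs_add scale X Y) W = qs_add scale (qs_times scale X W) (qs_times scale Y W)"
    and "qs_times scale W (qs_add scale X Y) = qs_add scale (qs_times scale W X) (qs_times scale W Y)"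
  using assms
  by (auto elim!: qs_cases simp: qs_times_class qs_add_class ftimes_left.add ftimes_add_right)

lemma qs_times_scale:
  assumes "X \<in> QS scale" "Y \<in> QS scale"
  shows "qs_times scale (qs_scale scale c X) Y = qs_scale scale c (qs_times scale X Y)"
    and "qs_times scale X (qs_scale scale c Y) = qs_scale scale c (qs_times scale X Y)"
  using assms
  by (auto elim!: qs_cases simp: qs_times_class qs_scale_class ftimes_left.scale ftimes_scale_right)

lemma qs_times_cons:
  assumes "X \<in> QS scale" "Y \<in> QS scale"
  shows "qs_times scale (qs_cons scale a X) (qs_cons scale b Y) =
    qs_add scale
      (qs_add scale (qs_cons scale a (qs_times scale X (qs_cons scale b Y)))
        (qs_cons scale b (qs_times scale (qs_cons scale a X) Y)))
      (qs_cons scale (a * b) (qs_times scale X Y))"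
  using assms
  by (auto elim!: qs_cases simp: qs_times_class qs_cons_class qs_add_class ftimes_cons)

end


section \<open>Basic facts: the multiple sums\<close>

lemma finite_index_lists: "finite (index_lists n l)"
  by (rule finite_subset[OF _ finite_lists_length_eq[of "{0<..<n}" l]])
    (auto simp: index_lists_def)

lemma multi_sum_Nil: "multi_sum psi n [] = 1"
proof -
  have "index_lists n 0 = {[]}" by (auto simp: index_lists_def)
  then show ?thesis by (simp add: multi_sum_def)
qed

context adams_algebra
begin

lemma psi_scale:
  assumes "n \<ge> 1"
  shows "psi n (scale c a) = scale c (psi n a)"
  using psi_mult[OF assms, of "scale c 1" a] psi_ground[OF assms, of c]
  by (simp flip: scale_mult_left)

lemma multi_sum_split:
  "multi_sum psi n (u @ a # v) =
    (\<Sum>ns\<in>index_lists n (length u + length v + 1). psi (ns ! length u) a *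
      (\<Prod>i\<in>{..<length u + length v + 1} - {length u}. psi (ns ! i) ((u @ 0 # v) ! i)))"
proof -
  have "(\<Prod>i<length u + length v + 1. psi (ns ! i) ((u @ a # v) ! i)) = psi (ns ! length u) a *
      (\<Prod>i\<in>{..<length u + length v + 1} - {length u}. psi (ns ! i) ((u @ 0 # v) ! i))" for ns
  proof (subst prod.remove[of _ "length u"])
    have "(u @ a # v) ! i = (u @ 0 # v) ! i" if "i \<noteq> length u" for i
      using that by (auto simp: nth_append nth_Cons split: nat.splits)
    then show "psi (ns ! length u) ((u @ a # v) ! length u) *
        (\<Prod>i\<in>{..<length u + length v + 1} - {length u}. psi (ns ! i) ((u @ a # v) ! i)) =
      psi (ns ! length u) a *
        (\<Prod>i\<in>{..<length u + length v + 1} - {length u}. psi (ns ! i) ((u @ 0 # v) ! i))"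
      by (auto intro!: arg_cong2[where f = "(*)"] prod.cong)
  qed auto
  then show ?thesis by (simp add: multi_sum_def)
qed

lemma index_lists_pos: "ns \<in> index_lists n l \<Longrightarrow> i < l \<Longrightarrow> ns ! i \<ge> 1"
  unfolding index_lists_def using nth_mem[of i ns] by fastforce

lemma multi_sum_add:
  "multi_sum psi n (u @ (a + b) # v) = multi_sum psi n (u @ a # v) + multi_sum psi n (u @ b # v)"
  unfolding multi_sum_split sum.distrib[symmetric]
  by (intro sum.cong) (simp_all add: psi_add[OF index_lists_pos] distrib_right)

lemma multi_sum_scale:
  "multi_sum psi n (u @ scale c a # v) = scale c (multi_sum psi n (u @ a # v))"
  unfolding multi_sum_split scale_sum_right
  by (intro sum.cong) (simp_all add: psi_scale[OF index_lists_pos] scale_mult_left)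

lemma Z_linear: "qs_linear scale scale (Z scale psi n)"
  unfolding Z_def
  by (intro qs_universal vector_space_axioms multi_sum_add multi_sum_scale)

lemma Z_tensor: "Z scale psi n (qs_tensor scale as) = multi_sum psi n as"
  unfolding Z_def
  by (intro qs_universal vector_space_axioms multi_sum_add multi_sum_scale)

lemma Z_one: "Z scale psi n (qs_one scale) = 1"
  by (simp add: qs_one_def Z_tensor multi_sum_Nil)

end

end

theory Submission
  imports Defs
begin

text \<open>
  Separating the terms with largest index \<open>n\<^sub>1 = n\<close> gives
  \<open>Z\<^bsub>n+1\<^esub>(a w) = Z\<^sub>n(a w) + \<psi>\<^sup>n(a) Z\<^sub>n(w)\<close>. Applied to the three terms of the quasi-shuffle
  recursion, this turns multiplicativity of \<open>Z\<^bsub>n+1\<^esub>\<close> on \<open>a u\<close> and \<open>b v\<close> into the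
  expansion of \<open>(Z\<^sub>n(a u) + \<psi>\<^sup>n(a) Z\<^sub>n(u)) (Z\<^sub>n(b v) + \<psi>\<^sup>n(b) Z\<^sub>n(v))\<close>, by
  induction on \<open>n\<close>.
\<close>

text \<open>Split on the head, the largest entry: if it is \<open>n\<close>, the tail lies below
  \<open>n\<close>; otherwise the whole list does. The bound \<open>n \<ge> 1\<close> makes
  \<open>n\<close> itself an admissible index.\<close>

lemma index_lists_Suc_Suc:
  assumes "n \<ge> 1"
  shows "index_lists (Suc n) (Suc l) = index_lists n (Suc l) \<union> (#) n ` index_lists n l"
proof (intro equalityI subsetI)
  fix ns assume ns: "ns \<in> index_lists (Suc n) (Suc l)"
  then obtain m ms where [simp]: "ns = m # ms"
    by (cases ns) (auto simp: index_lists_def)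
  show "ns \<in> index_lists n (Suc l) \<union> (#) n ` index_lists n l"
    using ns by (cases "m = n") (force simp: index_lists_def)+
next
  fix ns assume "ns \<in> index_lists n (Suc l) \<union> (#) n ` index_lists n l"
  then show "ns \<in> index_lists (Suc n) (Suc l)"
    using assms by (force simp: index_lists_def)
qed

lemma multi_sum_one_Cons: "multi_sum psi (Suc 0) (a # w) = 0"
proof -
  have "index_lists (Suc 0) (Suc (length w)) = {}"
    by (auto simp: index_lists_def length_Suc_conv)
  then show ?thesis by (simp add: multi_sum_def)
qed

lemma multi_sum_Suc_Cons:
  assumes "n \<ge> 1"
  shows "multi_sum psi (Suc n) (a # w) = multi_sum psi n (a # w) + psi n a * multi_sum psi n w"
proof -
  have "index_lists n (Suc (length w)) \<inter> (#) n ` index_lists n (length w) = {}"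
    by (auto simp: index_lists_def)
  then show ?thesis
    by (simp add: multi_sum_def index_lists_Suc_Suc[OF assms] finite_index_lists sum.union_disjoint
        sum.reindex prod.lessThan_Suc_shift sum_distrib_left del: prod.lessThan_Suc)
qed

context adams_algebra
begin

sublocale multi_sum: Vector_Spaces.linear fscale scale "lin_ext scale (multi_sum psi n)" for n
  by (rule lin_ext_linear) (rule vector_space_axioms)

lemma lin_ext_multi_sum_one_fcons: "lin_ext scale (multi_sum psi (Suc 0)) (fcons a f) = 0"
  by (induction f rule: free_induct)
    (simp_all add: fcons.zero fcons.add fcons.scale fcons_word multi_sum.zero multi_sum.add
      multi_sum.scale lin_ext_word[OF vector_space_axioms] multi_sum_one_Cons)

text \<open>The recursion is needed on linear combinations, because a quasi-shuffle of two words is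
  a sum of words.\<close>

lemma lin_ext_multi_sum_Suc_fcons:
  assumes "n \<ge> 1"
  shows "lin_ext scale (multi_sum psi (Suc n)) (fcons a f) =
    lin_ext scale (multi_sum psi n) (fcons a f) + psi n a * lin_ext scale (multi_sum psi n) f"
proof (induction f rule: free_induct)
  case (word c w)
  have "scale c (x * y) = x * scale c y" for x y
    using scale_mult_left[of c y x] by (simp add: mult.commute)
  then show ?case
    by (simp add: fcons.scale fcons_word multi_sum.scale lin_ext_word[OF vector_space_axioms]
        multi_sum_Suc_Cons[OF assms] scale_right_distrib)
qed (simp_all add: fcons.zero fcons.add multi_sum.zero multi_sum.add algebra_simps)

lemma lin_ext_multi_sum_quasi_shuffle:
  assumes "n \<ge> 1"
  shows "lin_ext scale (multi_sum psi n) (quasi_shuffle u v) = multi_sum psi n u * multi_sum psi n v"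
  using assms
proof (induction n arbitrary: u v rule: nat_induct_at_least)
  case base
  \<comment> \<open>No positive index lies below 1, so both sides are 0 unless both words are empty,
    when they are 1.\<close>
  show ?case
    by (cases u; cases v)
      (simp_all add: multi_sum.add lin_ext_word[OF vector_space_axioms] multi_sum_Nil
        multi_sum_one_Cons lin_ext_multi_sum_one_fcons)
next
  case (Suc n)
  show ?case
  proof (cases "u = [] \<or> v = []")
    case True
    then show ?thesis by (auto simp: lin_ext_word[OF vector_space_axioms] multi_sum_Nil)
  next
    case False
    then obtain a u' b v' where uv: "u = a # u'" "v = b # v'" by (meson neq_Nil_conv)
    let ?L = "lin_ext scale (multi_sum psi n)"
    \<comment> \<open>Each of the three \<open>fcons\<close> terms splits off a \<open>psi n\<close>
      part; what remains of them reassembles to \<open>?L (quasi_shuffle u v)\<close>.\<close>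
    have "lin_ext scale (multi_sum psi (Suc n)) (quasi_shuffle u v) =
        ?L (quasi_shuffle u v) + psi n a * ?L (quasi_shuffle u' v) +
        psi n b * ?L (quasi_shuffle u v') + psi n (a * b) * ?L (quasi_shuffle u' v')"
      by (simp add: uv multi_sum.add lin_ext_multi_sum_Suc_fcons[OF Suc.hyps] algebra_simps)
    \<comment> \<open>The induction hypothesis serves four different pairs of words, hence the
      generalisation over \<open>u\<close> and \<open>v\<close>; multiplicativity of
      \<open>psi n\<close> lets the last term factor.\<close>
    also have "\<dots> = multi_sum psi (Suc n) u * multi_sum psi (Suc n) v"
      unfolding Suc.IH psi_mult[OF Suc.hyps] uv multi_sum_Suc_Cons[OF Suc.hyps]
      by (simp add: algebra_simps)
    finally show ?thesis .
  qed
qed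

text \<open>Both sides are bilinear in \<open>f\<close> and \<open>g\<close>, so words
  suffice.\<close>

lemma lin_ext_multi_sum_ftimes:
  assumes "n \<ge> 1"
  shows "lin_ext scale (multi_sum psi n) (ftimes f g) =
    lin_ext scale (multi_sum psi n) f * lin_ext scale (multi_sum psi n) g"
proof (induction f rule: free_induct)
  case (word c u)
  show ?case
  proof (induction g rule: free_induct)
    case (word d v)
    have "scale c x * scale d y = scale c (scale d (x * y))" for x y
      by (metis scale_mult_left mult.commute)
    then show ?case
      by (simp add: ftimes_left.scale ftimes_scale_right ftimes_word multi_sum.scale
          lin_ext_word[OF vector_space_axioms] lin_ext_multi_sum_quasi_shuffle[OF assms])
  qed (simp_all add: ftimes_zero_right ftimes_add_right multi_sum.zero multi_sum.add algebra_simps)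
qed (simp_all add: ftimes_left.zero ftimes_left.add multi_sum.zero multi_sum.add algebra_simps)

text \<open>Multilinearity of \<open>multi_sum\<close> makes the value independent of the
  representative chosen by \<open>qs_rep\<close>.\<close>

lemma Z_class: "Z scale psi n (qs_class scale f) = lin_ext scale (multi_sum psi n) f"
  unfolding Z_def
  by (rule lin_ext_rep) (intro vector_space_axioms multi_sum_add multi_sum_scale)+

lemma Z_times:
  assumes "n \<ge> 1" "X \<in> QS scale" "Y \<in> QS scale"
  shows "Z scale psi n (qs_times scale X Y) = Z scale psi n X * Z scale psi n Y"
  using assms(2,3)
  by (auto elim!: qs_cases simp: qs_times_class Z_class lin_ext_multi_sum_ftimes[OF assms(1)])

end

theorem lemma2p1:
  fixes scale :: "'k::field_char_0 \<Rightarrow> 'a::comm_ring_1 \<Rightarrow> 'a"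
    and psi :: "nat \<Rightarrow> 'a \<Rightarrow> 'a"
    and n :: nat
  assumes "adams_algebra scale psi"
    and "n \<ge> 1"
  shows "qs_algebra_morphism scale (Z scale psi n)"
proof -
  interpret adams_algebra scale psi by fact
  show ?thesis
    using Z_linear Z_one Z_times[OF assms(2)] by (simp add: qs_algebra_morphism_def)
qed

end
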